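(* Let $n\ge 1$, let $\lambda_1,\dots,\lambda_n\ge 0$ and $c\in\mathbb{R}$, let $x^{\alpha(1)},\dots,x^{\alpha(n)}$ be squared monomials in $n$ real variables $x=(x_1,\dots,x_n)$ of degree at most $2d$, and let $$p(x)=\Big(\sum_{i=1}^n \lambda_i x^{\alpha(i)}\Big)\Big(\sum_{i=1}^n \lambda_i \prod_{j\neq i} x^{\alpha(j)}\Big)-c\prod_{i=1}^n x^{\alpha(i)}.$$ If $$K=\lambda_1^2+\cdots+\lambda_n^2-c\;<\;-2\sum_{1\le i<j\le n}\lambda_i\lambda_j,$$ then $p$ is not non-negative on $\mathbb{R}^n$, and consequently $p$ is not a sum of squares.
   Context: A squared monomial is $x^{\alpha}=x_1^{\alpha_1}\cdots x_n^{\alpha_n}$ with all $\alpha_k$ even non-negative integers. The $x^{\alpha(i)}$ are not required to be distinct. A polynomial is a sum of squares (SOS) if it equals $\sum_{i=1}^r f_i^2$ for some real polynomials $f_i$; it is non-negative if $p(x)\ge 0$ for all $x\in\mathbb{R}^n$. *)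

theory Defs
  imports "HOL-Analysis.Analysis" "HOL-Library.Poly_Mapping"
begin

text \<open>Real polynomials in the variables \<open>x\<^sub>k\<close>, \<open>k :: 'n\<close>, as finitely supported maps from
  exponent vectors to coefficients.  Ring operations are those of
  \<^theory>\<open>HOL-Library.Poly_Mapping\<close> (convolution product).\<close>

type_synonym 'n monomial_exp = "'n \<Rightarrow>\<^sub>0 nat"
type_synonym 'n real_mpoly = "'n monomial_exp \<Rightarrow>\<^sub>0 real"

definition const_poly :: "real \<Rightarrow> 'n real_mpoly" where
  "const_poly a = Poly_Mapping.single 0 a"

definition monom_poly :: "'n monomial_exp \<Rightarrow> 'n real_mpoly" where
  "monom_poly \<alpha> = Poly_Mapping.single \<alpha> 1"

definition monom_degree :: "('n::finite) monomial_exp \<Rightarrow> nat" where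
  "monom_degree \<alpha> = (\<Sum>k\<in>UNIV. Poly_Mapping.lookup \<alpha> k)"

definition is_squared_monomial :: "'n monomial_exp \<Rightarrow> bool" where
  "is_squared_monomial \<alpha> \<longleftrightarrow> (\<forall>k. even (Poly_Mapping.lookup \<alpha> k))"

definition poly_eval :: "('n::finite) real_mpoly \<Rightarrow> real ^ 'n \<Rightarrow> real" where
  "poly_eval p x =
     (\<Sum>\<alpha>\<in>Poly_Mapping.keys p.
        Poly_Mapping.lookup p \<alpha> * (\<Prod>k\<in>UNIV. (x $ k) ^ Poly_Mapping.lookup \<alpha> k))"

definition nonneg_poly :: "('n::finite) real_mpoly \<Rightarrow> bool" where
  "nonneg_poly p \<longleftrightarrow> (\<forall>x. poly_eval p x \<ge> 0)"

definition is_sos :: "'n real_mpoly \<Rightarrow> bool" where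
  "is_sos p \<longleftrightarrow> (\<exists>(r::nat) (f :: nat \<Rightarrow> 'n real_mpoly). p = (\<Sum>i=1..r. (f i)\<^sup>2))"

end

theory Submission
  imports Defs
begin

text \<open>At the point \<open>(1, \<dots>, 1)\<close> every monomial takes the value \<open>1\<close>, so
  there \<open>p\<close> has the value \<open>(\<Sum>i. \<lambda>\<^sub>i)\<^sup>2 - c\<close>.  Expanding the square turns this into
  \<open>K + 2 * (\<Sum>i<j. \<lambda>\<^sub>i * \<lambda>\<^sub>j)\<close>, which the hypothesis on \<open>K\<close> makes negative.  A sum of squares
  cannot be negative at a point, because evaluation at a point is a ring homomorphism; proving
  that homomorphism property for the finitely supported representation of polynomials
  (\<open>poly_eval_add\<close>, \<open>poly_eval_mult\<close>) is the main work.\<close>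

definition monom_eval :: "('n::finite) monomial_exp \<Rightarrow> real ^ 'n \<Rightarrow> real" where
  "monom_eval \<alpha> x = (\<Prod>k\<in>UNIV. (x $ k) ^ Poly_Mapping.lookup \<alpha> k)"

lemma monom_eval_add: "monom_eval (\<alpha> + \<beta>) x = monom_eval \<alpha> x * monom_eval \<beta> x"
  by (simp add: monom_eval_def lookup_add power_add prod.distrib)

text \<open>Summing over any finite superset of the support lets two polynomials with different
  supports be evaluated over a common index set.\<close>

lemma poly_eval_superset:
  assumes "finite A" "Poly_Mapping.keys p \<subseteq> A"
  shows "poly_eval p x = (\<Sum>\<alpha>\<in>A. Poly_Mapping.lookup p \<alpha> * monom_eval \<alpha> x)"
  unfolding poly_eval_def monom_eval_def
  by (rule sum.mono_neutral_left) (use assms in \<open>auto simp: in_keys_iff\<close>)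

lemma poly_eval_add: "poly_eval (p + q) x = poly_eval p x + poly_eval q x"
proof -
  let ?A = "Poly_Mapping.keys p \<union> Poly_Mapping.keys q"
  have "Poly_Mapping.keys (p + q) \<subseteq> ?A"
    by (rule keys_add)
  then show ?thesis
    by (simp add: poly_eval_superset[of ?A] lookup_add distrib_right sum.distrib)
qed

lemma poly_eval_0 [simp]: "poly_eval 0 x = 0"
  by (simp add: poly_eval_def)

lemma poly_eval_single [simp]: "poly_eval (Poly_Mapping.single \<alpha> a) x = a * monom_eval \<alpha> x"
  by (simp add: poly_eval_def monom_eval_def)

lemma poly_eval_sum: "poly_eval (sum f A) x = (\<Sum>i\<in>A. poly_eval (f i) x)"
  by (induction A rule: infinite_finite_induct) (simp_all add: poly_eval_add)

lemma poly_eval_diff: "poly_eval (p - q) x = poly_eval p x - poly_eval q x"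
  using poly_eval_add[of "p - q" q x] by simp

text \<open>By additivity in each factor it is enough to multiply single terms, where the claim says that
  exponents add.\<close>

lemma poly_eval_mult: "poly_eval (p * q) x = poly_eval p x * poly_eval q x"
proof -
  let ?term = "\<lambda>r \<alpha>. Poly_Mapping.single \<alpha> (Poly_Mapping.lookup r \<alpha>)"
  have expand: "r = (\<Sum>\<alpha>\<in>Poly_Mapping.keys r. ?term r \<alpha>)" for r :: "'a real_mpoly"
    by (rule poly_mapping_eqI)
      (simp add: lookup_sum lookup_single when_def in_keys_iff)
  have "p * q = (\<Sum>\<alpha>\<in>Poly_Mapping.keys p. \<Sum>\<beta>\<in>Poly_Mapping.keys q. ?term p \<alpha> * ?term q \<beta>)"
    by (subst expand[of p], subst expand[of q]) (rule sum_product)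
  then have "poly_eval (p * q) x =
      (\<Sum>\<alpha>\<in>Poly_Mapping.keys p. \<Sum>\<beta>\<in>Poly_Mapping.keys q.
        (Poly_Mapping.lookup p \<alpha> * monom_eval \<alpha> x) * (Poly_Mapping.lookup q \<beta> * monom_eval \<beta> x))"
    by (simp add: poly_eval_sum mult_single monom_eval_add mult_ac)
  also have "\<dots> = poly_eval p x * poly_eval q x"
    by (simp add: poly_eval_def monom_eval_def sum_product)
  finally show ?thesis .
qed

lemma poly_eval_const [simp]: "poly_eval (const_poly a) x = a"
  by (simp add: const_poly_def monom_eval_def)

lemma poly_eval_monom: "poly_eval (monom_poly \<alpha>) x = monom_eval \<alpha> x"
  by (simp add: monom_poly_def)

lemma poly_eval_prod: "poly_eval (prod f A) x = (\<Prod>i\<in>A. poly_eval (f i) x)"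
proof (induction A rule: infinite_finite_induct)
  case (infinite A)
  then show ?case
    using poly_eval_const[of 1 x] by (simp add: const_poly_def)
next
  case empty
  then show ?case
    using poly_eval_const[of 1 x] by (simp add: const_poly_def)
next
  case (insert a A)
  then show ?case
    by (simp add: poly_eval_mult)
qed

lemma is_sos_imp_nonneg_poly:
  assumes "is_sos p"
  shows "nonneg_poly p"
proof -
  obtain r :: nat and f where "p = (\<Sum>i=1..r. (f i)\<^sup>2)"
    using assms unfolding is_sos_def by blast
  then show ?thesis
    by (simp add: nonneg_poly_def poly_eval_sum power2_eq_square poly_eval_mult sum_nonneg)
qed

lemma poly_eval_monom_ones [simp]: "poly_eval (monom_poly \<alpha>) 1 = 1"
  by (simp add: poly_eval_monom monom_eval_def)

lemma square_sum_eq_diagonal_plus_pairs: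
  fixes a :: "nat \<Rightarrow> 'a::comm_semiring_1"
  shows "(\<Sum>i=1..n. a i)\<^sup>2 =
    (\<Sum>i=1..n. (a i)\<^sup>2) + 2 * (\<Sum>(i, j)\<in>{(i, j). 1 \<le> i \<and> i < j \<and> j \<le> n}. a i * a j)"
proof (induction n)
  case 0
  have "(\<Sum>(i, j)\<in>{(i, j). 1 \<le> i \<and> i < j \<and> j \<le> (0::nat)}. a i * a j) = 0"
    by (rule sum.neutral) auto
  then show ?case
    by simp
next
  case (Suc n)
  let ?P = "\<lambda>n. {(i, j). 1 \<le> i \<and> i < j \<and> j \<le> (n::nat)}"
  let ?new = "(\<lambda>i. (i, Suc n)) ` {1..n}"
  \<comment> \<open>The pairs gained in passing to \<open>Suc n\<close> are those with larger entry \<open>Suc n\<close>.\<close>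
  have "?P (Suc n) = ?P n \<union> ?new"
    by (auto simp: le_Suc_eq)
  moreover have "finite (?P n)"
    by (rule finite_subset[of _ "{1..n} \<times> {1..n}"]) auto
  moreover have "?P n \<inter> ?new = {}"
    by auto
  moreover have "(\<Sum>(i, j)\<in>?new. a i * a j) = (\<Sum>i=1..n. a i) * a (Suc n)"
    by (subst sum.reindex) (auto simp: inj_on_def sum_distrib_right)
  ultimately have "(\<Sum>(i, j)\<in>?P (Suc n). a i * a j) =
      (\<Sum>(i, j)\<in>?P n. a i * a j) + (\<Sum>i=1..n. a i) * a (Suc n)"
    by (simp add: sum.union_disjoint)
  with Suc.IH show ?case
    by (simp add: power2_sum distrib_left add_ac mult_ac)
qed

theorem theorem2p6:
  fixes n d :: nat
    and lam :: "nat \<Rightarrow> real"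
    and c K :: real
    and \<alpha> :: "nat \<Rightarrow> ('n::finite) monomial_exp"
    and p :: "'n real_mpoly"
  assumes "n = CARD('n)"
    and "\<And>i. i \<in> {1..n} \<Longrightarrow> lam i \<ge> 0"
    and "\<And>i. i \<in> {1..n} \<Longrightarrow> is_squared_monomial (\<alpha> i)"
    and "\<And>i. i \<in> {1..n} \<Longrightarrow> monom_degree (\<alpha> i) \<le> 2 * d"
    and "p = (\<Sum>i=1..n. const_poly (lam i) * monom_poly (\<alpha> i)) *
             (\<Sum>i=1..n. const_poly (lam i) * (\<Prod>j\<in>{1..n} - {i}. monom_poly (\<alpha> j)))
             - const_poly c * (\<Prod>i=1..n. monom_poly (\<alpha> i))"
    and "K = (\<Sum>i=1..n. (lam i)\<^sup>2) - c"
    and "K < - 2 * (\<Sum>(i, j)\<in>{(i, j). 1 \<le> i \<and> i < j \<and> j \<le> n}. lam i * lam j)"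
  shows "\<not> nonneg_poly p \<and> \<not> is_sos p"
proof -
  have "poly_eval p 1 = (\<Sum>i=1..n. lam i)\<^sup>2 - c"
    unfolding \<open>p = _\<close>
    by (simp add: poly_eval_diff poly_eval_mult poly_eval_sum poly_eval_prod power2_eq_square)
  also have "\<dots> < 0"
    using assms(6,7) square_sum_eq_diagonal_plus_pairs[of lam n] by linarith
  finally have "\<not> nonneg_poly p"
    unfolding nonneg_poly_def by (meson not_le)
  then show ?thesis
    using is_sos_imp_nonneg_poly by blast
qed

end
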